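(* Consider the telegraph process driven by Bernoulli trials with parameter $p=b/(b+r)\in(0,1)$ and velocities $c>0$, $-v<0$ described in the context, and assume that $U_k$ and $D_k$ are exponentially distributed with rates $\lambda k$ and $\mu k$, $k=1,2,\dots$, respectively, where $\lambda,\mu>0$. If $\lambda v=\mu c$, then the density $p(x,t)$ of the absolutely continuous component of the law of $S_t$ is the truncated logistic density $$p(x,t)=\frac{e^{-(x-m)/s}}{s\left[1+e^{-(x-m)/s}\right]^2},\qquad -vt<x<ct,\ t>0,$$ where $$m=s\ln\left(\frac{p}{1-p}\right),\qquad s=\frac v\mu=\frac c\lambda.$$ Hence, in this case $S_t$ admits the stationary density $$\lim_{t\to+\infty}p(x,t)=\frac{e^{-(x-m)/s}}{s\left[1+e^{-(x-m)/s}\right]^2},\qquad x\in\mathbb{R}.$$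
   Context: Model (Bernoulli scheme, $A=0$). Fix $c,v>0$ and $b,r>0$, and set $p=b/(b+r)$. Let $\{X_n;n\ge1\}$ be i.i.d. with $\mathbb{P}\{X_n=1\}=p=1-\mathbb{P}\{X_n=0\}$. Put $Z_n=c$ if $X_{n+1}=1$ and $Z_n=-v$ if $X_{n+1}=0$, $n\ge0$. Let $\{U_k;k\ge1\}$ and $\{D_k;k\ge1\}$ be mutually independent sequences of independent non-negative random variables, the collection $\{U_k,D_k;k\ge1\}$ being independent of $\{X_n;n\ge1\}$. $U_k$ (resp. $D_k$) is the duration of the $k$-th period during which the particle has velocity $c$ (resp. $-v$): $T_0=0$ and, for $n\ge0$, with $j_n=X_1+\cdots+X_{n+1}$, $T_{n+1}=T_n+U_{j_n}$ if $X_{n+1}=1$ and $T_{n+1}=T_n+D_{n+1-j_n}$ if $X_{n+1}=0$. Let $M_t=\max\{i\ge1:T_i\le t\}$ (with $M_t=0$ if $T_1>t$). The velocity and position at time $t$ are $V_t=Z_{M_t}$ and $S_t=\int_0^tV_s\,ds$, so $S_0=0$ and $V_0=Z_0$. Density. For $t>0$ and $x\in(-vt,ct)$: $p(x,t)=\frac{\partial}{\partial x}\mathbb{P}\{S_t\le x\}$ (the law of $S_t$ also has atoms at $-vt$ and $ct$). The constant $p$ (no arguments) denotes the Bernoulli parameter. "Stationary density" refers to the pointwise limit of $p(x,t)$ as $t\to+\infty$ for fixed $x$. *)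

theory Defs
  imports "HOL-Probability.Probability"
begin

text \<open>
  The sequences \<open>X\<close>, \<open>U\<close>, \<open>D\<close> are indexed from 1; their values at index 0 are irrelevant.
  Mutual independence of all the \<open>X n\<close>, \<open>U k\<close>, \<open>D k\<close> is expressed by a single
  real-valued family indexed by a disjoint sum.
\<close>

locale bernoulli_telegraph = prob_space M
  for M :: "'a measure" +
  fixes X :: "nat \<Rightarrow> 'a \<Rightarrow> nat" and U D :: "nat \<Rightarrow> 'a \<Rightarrow> real" and c v b r :: real
  assumes c_pos: "c > 0" and v_pos: "v > 0" and b_pos: "b > 0" and r_pos: "r > 0"
    and X_rv: "\<And>n. n \<ge> 1 \<Longrightarrow> X n \<in> measurable M (count_space UNIV)"
    and X_binary: "\<And>n \<omega>. n \<ge> 1 \<Longrightarrow> \<omega> \<in> space M \<Longrightarrow> X n \<omega> \<in> {0, 1}"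
    and X_one: "\<And>n. n \<ge> 1 \<Longrightarrow> prob {\<omega> \<in> space M. X n \<omega> = 1} = b / (b + r)"
    and X_zero: "\<And>n. n \<ge> 1 \<Longrightarrow> prob {\<omega> \<in> space M. X n \<omega> = 0} = 1 - b / (b + r)"
    and U_nonneg: "\<And>k. k \<ge> 1 \<Longrightarrow> AE \<omega> in M. 0 \<le> U k \<omega>"
    and D_nonneg: "\<And>k. k \<ge> 1 \<Longrightarrow> AE \<omega> in M. 0 \<le> D k \<omega>"
    and indep: "indep_vars (\<lambda>_. borel)
          (case_sum (\<lambda>n \<omega>. real (X n \<omega>)) (case_sum U D))
          ({1..} <+> ({1..} <+> {1..}))"

definition velocity_seq :: "(nat \<Rightarrow> 'a \<Rightarrow> nat) \<Rightarrow> real \<Rightarrow> real \<Rightarrow> nat \<Rightarrow> 'a \<Rightarrow> real" where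
  "velocity_seq X c v n \<omega> = (if X (n + 1) \<omega> = 1 then c else - v)"

text \<open>
  Among the first \<open>n + 1\<close> trials, \<open>successes X n\<close> have outcome 1. The other
  \<open>n + 1 - successes X n\<close> have outcome 0, so the subtraction on the natural numbers in
  \<open>renewal_time\<close> is not truncated, and its result is at least 1 where it indexes \<open>D\<close>.
\<close>

definition successes :: "(nat \<Rightarrow> 'a \<Rightarrow> nat) \<Rightarrow> nat \<Rightarrow> 'a \<Rightarrow> nat" where
  "successes X n \<omega> = (\<Sum>i = 1..n + 1. X i \<omega>)"

primrec renewal_time ::
  "(nat \<Rightarrow> 'a \<Rightarrow> nat) \<Rightarrow> (nat \<Rightarrow> 'a \<Rightarrow> real) \<Rightarrow> (nat \<Rightarrow> 'a \<Rightarrow> real) \<Rightarrow> nat \<Rightarrow> 'a \<Rightarrow> real" where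
  "renewal_time X U D 0 \<omega> = 0"
| "renewal_time X U D (Suc n) \<omega> = renewal_time X U D n \<omega> +
     (if X (n + 1) \<omega> = 1 then U (successes X n \<omega>) \<omega> else D (n + 1 - successes X n \<omega>) \<omega>)"

text \<open>
  If the renewal times accumulate before time \<open>t\<close>, the set below is infinite and its \<open>Max\<close> is
  a fixed unspecified number; under the exponential rates considered this has probability 0.
\<close>

definition renewal_count ::
  "(nat \<Rightarrow> 'a \<Rightarrow> nat) \<Rightarrow> (nat \<Rightarrow> 'a \<Rightarrow> real) \<Rightarrow> (nat \<Rightarrow> 'a \<Rightarrow> real) \<Rightarrow> real \<Rightarrow> 'a \<Rightarrow> nat" where
  "renewal_count X U D t \<omega> =
     (if renewal_time X U D 1 \<omega> > t then 0 else Max {i. i \<ge> 1 \<and> renewal_time X U D i \<omega> \<le> t})"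

definition velocity ::
  "(nat \<Rightarrow> 'a \<Rightarrow> nat) \<Rightarrow> (nat \<Rightarrow> 'a \<Rightarrow> real) \<Rightarrow> (nat \<Rightarrow> 'a \<Rightarrow> real) \<Rightarrow> real \<Rightarrow> real \<Rightarrow> real \<Rightarrow> 'a \<Rightarrow> real"
  where
  "velocity X U D c v t \<omega> = velocity_seq X c v (renewal_count X U D t \<omega>) \<omega>"

definition position ::
  "(nat \<Rightarrow> 'a \<Rightarrow> nat) \<Rightarrow> (nat \<Rightarrow> 'a \<Rightarrow> real) \<Rightarrow> (nat \<Rightarrow> 'a \<Rightarrow> real) \<Rightarrow> real \<Rightarrow> real \<Rightarrow> real \<Rightarrow> 'a \<Rightarrow> real"
  where
  "position X U D c v t \<omega> = (LINT u:{0..t}|lborel. velocity X U D c v u \<omega>)"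

definition position_density ::
  "'a measure \<Rightarrow> (nat \<Rightarrow> 'a \<Rightarrow> nat) \<Rightarrow> (nat \<Rightarrow> 'a \<Rightarrow> real) \<Rightarrow> (nat \<Rightarrow> 'a \<Rightarrow> real) \<Rightarrow>
     real \<Rightarrow> real \<Rightarrow> real \<Rightarrow> real \<Rightarrow> real" where
  "position_density M X U D c v x t =
     deriv (\<lambda>y. measure M {\<omega> \<in> space M. position X U D c v t \<omega> \<le> y}) x"

text \<open>
  Lebesgue decomposition: \<open>f\<close> is a density of the absolutely continuous component of \<open>N\<close>,
  the remaining component \<open>K\<close> being carried by a Lebesgue null set.
\<close>

definition ac_component_density :: "real measure \<Rightarrow> (real \<Rightarrow> real) \<Rightarrow> bool" where
  "ac_component_density N f \<longleftrightarrow>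
     f \<in> borel_measurable borel \<and> (\<forall>x. 0 \<le> f x) \<and>
     (\<exists>K :: real measure. sets K = sets borel \<and>
        (\<exists>B \<in> null_sets lborel. emeasure K (- B) = 0) \<and>
        (\<forall>A \<in> sets borel. emeasure N A = emeasure (density lborel f) A + emeasure K A))"

end

theory Submission
  imports Defs
begin

text \<open>
  Record the total time \<open>a\<close> spent moving up and the total time \<open>d\<close> spent moving down. As real
  time runs, the point \<open>(a, d)\<close> draws a staircase in the quadrant: every trial with outcome 1
  adds a horizontal step, every trial with outcome 0 a vertical one. At time \<open>t\<close> the point is on
  the line \<open>a + d = t\<close>, and the position is \<open>c * a - v * d\<close>. Let \<open>(w, z)\<close> be the point of that
  line with \<open>c * w - v * z = x\<close>. The staircase leaves the rectangle \<open>[0, w] \<times> [0, z]\<close> either through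
  its right side, and then the position at time \<open>t = w + z\<close> is at least \<open>x\<close>, or through its top,
  and then it is at most \<open>x\<close>: after the exit the velocity stays between \<open>- v\<close> and \<open>c\<close>, which
  is too little to bring the point back to the other side of \<open>(w, z)\<close>.

  The exit probabilities are explicit. A sum of independent exponential times with rates
  \<open>lam, 2 * lam, \<dots>, k * lam\<close> is at most \<open>w\<close> with probability \<open>A ^ k\<close>, where
  \<open>A = 1 - exp (- (lam * w))\<close> (\<open>linear_rate_partial_sum_cdf\<close>). Likewise \<open>k\<close> downward periods have
  total length at most \<open>z\<close> with probability \<open>B ^ k\<close>, where \<open>B = 1 - exp (- (mu * z))\<close>. Summing
  over the outcomes of the first \<open>n\<close> trials, each trial contributes the factor
  \<open>p * A + (1 - p) * B\<close>, so that the staircase is still in the rectangle after \<open>n\<close> trials with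
  probability \<open>(p * A + (1 - p) * B) ^ n\<close> (\<open>prob_clocks_before_trial\<close>). The exit at the next
  trial is through the right side with the additional factor \<open>p * (1 - A)\<close> and through the top
  with \<open>(1 - p) * (1 - B)\<close>. The geometric series gives exit probabilities
  \<open>P / (P + Q)\<close> and \<open>Q / (P + Q)\<close> with \<open>P = p * exp (- (lam * w))\<close> and
  \<open>Q = (1 - p) * exp (- (mu * z))\<close>.

  If \<open>lam * v = mu * c\<close>, the exponent \<open>lam * w - mu * z\<close> equals \<open>x / s\<close> and does not depend on
  \<open>t\<close>. Hence \<open>Q / (P + Q)\<close> is the logistic distribution function at \<open>x\<close>, for every \<open>x\<close> in the
  closed interval \<open>[- v * t, c * t]\<close>. The two exits yield \<open>F x \<le> P(S \<le> x)\<close> and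
  \<open>P(S < x) \<le> F x\<close> (\<open>cdf_bounds\<close>). Continuity of \<open>F\<close> turns these into equalities, at the end
  points too from inside the interval (\<open>cdf_eq_of_squeeze\<close>). So inside the open interval the law
  has the logistic density, and all the remaining mass sits in the two end points.
\<close>

section \<open>Partial sums of exponential times with linearly growing rates\<close>

lemma (in prob_space) emeasure_sum_le_convolution:
  fixes Y Z :: "'a \<Rightarrow> real"
  assumes indep: "indep_var borel Z borel Y" and dens: "distributed M lborel Z f"
  shows "emeasure M {\<omega> \<in> space M. Z \<omega> + Y \<omega> \<le> w} =
    (\<integral>\<^sup>+u. f u * ennreal (prob {\<omega> \<in> space M. Y \<omega> \<le> w - u}) \<partial>lborel)"
proof -
  have [measurable]: "random_variable borel Z" "random_variable borel Y"
    using indep_var_rv1[OF indep] indep_var_rv2[OF indep] .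
  have [measurable]: "f \<in> borel_measurable borel"
    using distributed_borel_measurable[OF dens] by simp
  interpret Y: prob_space "distr M borel Y" by (rule prob_space_distr) simp
  let ?H = "{q. fst q + snd q \<le> w} :: (real \<times> real) set"
  have "closed ?H"
    by (intro closed_Collect_le continuous_intros)
  then have H: "?H \<in> sets (borel \<Otimes>\<^sub>M borel)"
    unfolding borel_prod by simp
  have Zd: "distr M borel Z = density lborel f"
    using dens unfolding distributed_def by (metis distr_cong sets_lborel)
  have "emeasure M {\<omega> \<in> space M. Z \<omega> + Y \<omega> \<le> w}
      = emeasure (distr M (borel \<Otimes>\<^sub>M borel) (\<lambda>\<omega>. (Z \<omega>, Y \<omega>))) ?H"
    using H by (subst emeasure_distr) (auto intro!: arg_cong[where f="emeasure M"])
  also have "\<dots> = emeasure (distr M borel Z \<Otimes>\<^sub>M distr M borel Y) ?H"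
    using indep unfolding indep_var_distribution_eq by simp
  also have "\<dots> = (\<integral>\<^sup>+u. emeasure (distr M borel Y) (Pair u -` ?H) \<partial>distr M borel Z)"
    by (rule Y.emeasure_pair_measure_alt) (simp only: H sets_pair_measure_cong[OF sets_distr sets_distr])
  also have "\<dots> = (\<integral>\<^sup>+u. ennreal (prob {\<omega> \<in> space M. Y \<omega> \<le> w - u}) \<partial>distr M borel Z)"
  proof (rule nn_integral_cong)
    fix u
    have "Pair u -` ?H = {..w - u}" by auto
    then show "emeasure (distr M borel Y) (Pair u -` ?H) = ennreal (prob {\<omega> \<in> space M. Y \<omega> \<le> w - u})"
      by (simp add: emeasure_distr vimage_def Int_def conj_commute emeasure_eq_measure)
  qed
  also have "\<dots> = (\<integral>\<^sup>+u. f u * ennreal (prob {\<omega> \<in> space M. Y \<omega> \<le> w - u}) \<partial>lborel)"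
    unfolding Zd
  proof (rule nn_integral_density)
    have *: "prob {\<omega> \<in> space M. Y \<omega> \<le> w - u} = measure (distr M borel Y) (Pair u -` ?H)" for u
    proof -
      have "Pair u -` ?H = {..w - u}" by auto
      then show ?thesis by (simp add: measure_distr vimage_def Int_def conj_commute)
    qed
    have "(\<lambda>u. emeasure (distr M borel Y) (Pair u -` ?H)) \<in> borel_measurable borel"
      by (rule Y.measurable_emeasure_Pair)
        (simp only: H sets_pair_measure_cong[OF refl sets_distr])
    then show "(\<lambda>u. ennreal (prob {\<omega> \<in> space M. Y \<omega> \<le> w - u})) \<in> borel_measurable lborel"
      unfolding * by (simp add: Y.emeasure_eq_measure)
  qed simp
  finally show ?thesis .
qed

lemma (in prob_space) exponential_AE_pos:
  assumes "distributed M lborel Y (exponential_density l)" and "0 < l"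
  shows "AE \<omega> in M. 0 < Y \<omega>"
proof -
  have "prob {\<omega> \<in> space M. 0 < Y \<omega>} = 1"
    using exponential_distributedD_gt[OF assms(1), of 0] assms(2) by simp
  moreover have "{\<omega> \<in> space M. 0 < Y \<omega>} \<in> events"
    using distributed_measurable[OF assms(1)] by measurable
  ultimately show ?thesis
    using prob_eq_1[of "{\<omega> \<in> space M. 0 < Y \<omega>}"] by auto
qed

text \<open>
  The right-hand side is the distribution function of the maximum of \<open>k\<close> independent exponential
  times with rate \<open>l\<close>: the gaps between their order statistics are independent and exponential with
  rates \<open>l * k, \<dots>, l\<close> (the Yule process). The proof is an induction on \<open>k\<close> by convolution. The
  integrand of the convolution has an elementary primitive.
\<close>

lemma (in prob_space) linear_rate_partial_sum_cdf:
  fixes Y :: "nat \<Rightarrow> 'a \<Rightarrow> real"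
  assumes indep: "indep_vars (\<lambda>_. borel) Y {1..}"
    and exponential: "\<And>k. k \<ge> 1 \<Longrightarrow> distributed M lborel (Y k) (exponential_density (l * real k))"
    and "0 < l" "0 \<le> w"
  shows "prob {\<omega> \<in> space M. (\<Sum>i = 1..k. Y i \<omega>) \<le> w} = (1 - exp (- (l * w))) ^ k"
  using \<open>0 \<le> w\<close>
proof (induction k arbitrary: w)
  case 0
  then show ?case by (simp add: prob_space)
next
  case (Suc k)
  have [measurable]: "random_variable borel (Y i)" if "i \<ge> 1" for i
    using distributed_measurable[OF exponential[OF that]] by simp
  have sum_m[measurable]: "(\<lambda>\<omega>. \<Sum>i = 1..k. Y i \<omega>) \<in> borel_measurable M"
    by (rule borel_measurable_sum) simp
  \<comment> \<open>\<open>g\<close> is the density of \<open>Y (Suc k)\<close> at \<open>u\<close> times \<open>(1 - exp (- (l * (w - u)))) ^ k\<close>, rearranged so that its primitive \<open>G\<close> is visible.\<close>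
  define g where "g u = (l * real (Suc k)) * exp (- (l * u)) * (exp (- (l * u)) - exp (- (l * w))) ^ k" for u
  define G where "G u = - ((exp (- (l * u)) - exp (- (l * w))) ^ Suc k)" for u
  have AE: "AE \<omega> in M. 0 \<le> (\<Sum>i = 1..k. Y i \<omega>)"
  proof -
    have "AE \<omega> in M. \<forall>i\<in>{1..k}. 0 < Y i \<omega>"
      using exponential \<open>0 < l\<close> by (intro AE_finite_allI) (auto intro!: exponential_AE_pos)
    then show ?thesis by eventually_elim (intro sum_nonneg less_imp_le, blast)
  qed
  have neg: "prob {\<omega> \<in> space M. (\<Sum>i = 1..k. Y i \<omega>) \<le> a} = 0" if "a < 0" for a
    using AE that by (intro measure_eq_0_null_sets AE_iff_null_sets[THEN iffD2]) (auto elim!: eventually_mono)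
  have "indep_var borel (Y (Suc k)) borel (\<lambda>\<omega>. \<Sum>i = 1..k. Y i \<omega>)"
    by (rule indep_vars_sum) (auto intro: indep_vars_subset[OF indep])
  note conv = emeasure_sum_le_convolution[OF this exponential, of w]
  have "emeasure M {\<omega> \<in> space M. (\<Sum>i = 1..Suc k. Y i \<omega>) \<le> w}
     = emeasure M {\<omega> \<in> space M. Y (Suc k) \<omega> + (\<Sum>i = 1..k. Y i \<omega>) \<le> w}"
    by (simp add: add.commute)
  also have "\<dots> = (\<integral>\<^sup>+u. ennreal (exponential_density (l * real (Suc k)) u) *
      ennreal (prob {\<omega> \<in> space M. (\<Sum>i = 1..k. Y i \<omega>) \<le> w - u}) \<partial>lborel)"
    by (rule conv) simp
  also have "\<dots> = (\<integral>\<^sup>+u. ennreal (g u) * indicator {0..w} u \<partial>lborel)"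
  proof (rule nn_integral_cong)
    fix u :: real
    have "exp (- (l * w)) \<le> exp (- (l * u))" if "u \<le> w"
      using that \<open>0 < l\<close> by simp
    moreover have "exp (- (u * (l * real (Suc k)))) * (1 - exp (- (l * (w - u)))) ^ k
       = exp (- (l * u)) * (exp (- (l * u)) - exp (- (l * w))) ^ k"
    proof -
      have "exp (- (u * (l * real (Suc k)))) = exp (- (l * u)) * exp (- (l * u)) ^ k"
        by (simp add: exp_of_nat_mult[symmetric] exp_add[symmetric] algebra_simps)
      moreover have "exp (- (l * u)) * (1 - exp (- (l * (w - u)))) = exp (- (l * u)) - exp (- (l * w))"
        by (simp add: algebra_simps exp_add[symmetric])
      ultimately show ?thesis by (metis (no_types, lifting) mult.assoc power_mult_distrib)
    qed
    ultimately show "ennreal (exponential_density (l * real (Suc k)) u) *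
        ennreal (prob {\<omega> \<in> space M. (\<Sum>i = 1..k. Y i \<omega>) \<le> w - u}) = ennreal (g u) * indicator {0..w} u"
      using Suc.IH[of "w - u"] neg[of "w - u"] \<open>0 < l\<close>
      by (cases "u < 0"; cases "u \<le> w")
        (auto simp: g_def exponential_density_def ennreal_mult[symmetric] mult.assoc
          intro!: arg_cong[where f=ennreal])
  qed
  also have "\<dots> = ennreal (G w - G 0)"
  proof (rule nn_integral_FTC_Icc)
    show "g \<in> borel_measurable borel" unfolding g_def by measurable
    show "DERIV G u :> g u" for u
      unfolding g_def G_def by (auto intro!: derivative_eq_intros simp del: power_Suc simp: algebra_simps)
    show "0 \<le> g u" if "u \<in> {0..w}" for u
      using that \<open>0 < l\<close> unfolding g_def by (auto intro!: mult_nonneg_nonneg zero_le_power)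
  qed fact
  finally have "emeasure M {\<omega> \<in> space M. (\<Sum>i = 1..Suc k. Y i \<omega>) \<le> w} = ennreal ((1 - exp (- (l * w))) ^ Suc k)"
    by (simp add: G_def)
  moreover have "0 \<le> (1 - exp (- (l * w))) ^ Suc k"
    using \<open>0 < l\<close> Suc.prems by (intro zero_le_power) simp
  ultimately show ?case by (simp add: measure_def del: power_Suc)
qed

text \<open>
  One statement covers single members of the family (singleton blocks) and partial sums, which is
  what is needed to combine trials and clocks.
\<close>

lemma (in prob_space) indep_vars_block_sums:
  fixes Y :: "'i \<Rightarrow> 'a \<Rightarrow> real"
  assumes "indep_vars (\<lambda>_. borel) Y I" "\<And>j. j \<in> J \<Longrightarrow> K j \<subseteq> I" "disjoint_family_on K J"
  shows "indep_vars (\<lambda>_. borel) (\<lambda>j \<omega>. \<Sum>i\<in>K j. Y i \<omega>) J"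
proof -
  have "indep_vars (\<lambda>_. borel) (\<lambda>j \<omega>. (\<lambda>g. \<Sum>i\<in>K j. g i) (restrict (\<lambda>i. Y i \<omega>) (K j))) J"
    by (rule indep_vars_compose2[OF indep_vars_restrict[OF assms]])
      (auto intro!: borel_measurable_sum)
  then show ?thesis by simp
qed

section \<open>The staircase of the two clocks along a fixed path\<close>

definition clock :: "(nat \<Rightarrow> 'a \<Rightarrow> real) \<Rightarrow> nat \<Rightarrow> 'a \<Rightarrow> real" where
  "clock Y k \<omega> = (\<Sum>i = 1..k. Y i \<omega>)"

definition ones :: "(nat \<Rightarrow> 'a \<Rightarrow> nat) \<Rightarrow> nat \<Rightarrow> 'a \<Rightarrow> nat" where
  "ones X n \<omega> = (\<Sum>i = 1..n. X i \<omega>)"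

lemma clock_0 [simp]: "clock Y 0 \<omega> = 0"
  by (simp add: clock_def)

lemma clock_Suc [simp]: "clock Y (Suc k) \<omega> = clock Y k \<omega> + Y (Suc k) \<omega>"
  by (simp add: clock_def)

lemma ones_0 [simp]: "ones X 0 \<omega> = 0"
  by (simp add: ones_def)

lemma ones_Suc [simp]: "ones X (Suc n) \<omega> = ones X n \<omega> + X (Suc n) \<omega>"
  by (simp add: ones_def)

locale telegraph_path =
  fixes X :: "nat \<Rightarrow> 'a \<Rightarrow> nat" and U D :: "nat \<Rightarrow> 'a \<Rightarrow> real" and \<omega> :: 'a
  assumes binary: "\<And>i. i \<ge> 1 \<Longrightarrow> X i \<omega> \<in> {0, 1}"
begin

lemma ones_le: "ones X n \<omega> \<le> n"
proof (induction n)
  case (Suc n)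
  then show ?case using binary[of "Suc n"] by auto
qed simp

text \<open>
  The staircase picture: after \<open>n\<close> trials the elapsed time splits into the upward and the downward
  clock.
\<close>

lemma renewal_time_eq_clocks:
  "renewal_time X U D n \<omega> = clock U (ones X n \<omega>) \<omega> + clock D (n - ones X n \<omega>) \<omega>"
proof (induction n)
  case (Suc n)
  have "X (Suc n) \<omega> = 0 \<or> X (Suc n) \<omega> = 1" using binary[of "Suc n"] by simp
  moreover have "successes X n \<omega> = ones X (Suc n) \<omega>"
    by (simp add: successes_def ones_def)
  ultimately show ?case using Suc ones_le[of n] by (auto simp: Suc_diff_le)
qed simp

end

text \<open>
  From here on, renewal times are handled through the two clocks.
\<close>

declare renewal_time.simps(2) [simp del]

locale nonneg_telegraph_path = telegraph_path X U D \<omega>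
  for X :: "nat \<Rightarrow> 'a \<Rightarrow> nat" and U D :: "nat \<Rightarrow> 'a \<Rightarrow> real" and \<omega> :: 'a +
  fixes c v :: real
  assumes speeds: "0 < c" "0 < v"
    and nonneg: "\<And>k. k \<ge> 1 \<Longrightarrow> 0 \<le> U k \<omega>" "\<And>k. k \<ge> 1 \<Longrightarrow> 0 \<le> D k \<omega>"
begin

abbreviation "T n \<equiv> renewal_time X U D n \<omega>"
abbreviation "V t \<equiv> velocity X U D c v t \<omega>"
abbreviation "up n \<equiv> clock U (ones X n \<omega>) \<omega>"
abbreviation "down n \<equiv> clock D (n - ones X n \<omega>) \<omega>"

text \<open>
  These bounds hold at every time, also after a possible accumulation point of the renewal times.
  They control the position after the staircase has left the rectangle.
\<close>

lemma V_bounds: "- v \<le> V t" "V t \<le> c"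
  using speeds by (auto simp: velocity_def velocity_seq_def)

lemma clock_mono: "j \<le> k \<Longrightarrow> clock U j \<omega> \<le> clock U k \<omega>" "j \<le> k \<Longrightarrow> clock D j \<omega> \<le> clock D k \<omega>"
  unfolding clock_def by (auto intro!: sum_mono2 nonneg)

lemma ones_mono: "j \<le> k \<Longrightarrow> ones X j \<omega> \<le> ones X k \<omega>"
  unfolding ones_def by (rule sum_mono2) auto

lemma zeros_mono: "j \<le> k \<Longrightarrow> j - ones X j \<omega> \<le> k - ones X k \<omega>"
proof (induction k rule: dec_induct)
  case (step n)
  have "X (Suc n) \<omega> \<le> 1" using binary[of "Suc n"] by auto
  then show ?case using step by simp
qed simp

lemma up_mono: "j \<le> k \<Longrightarrow> up j \<le> up k" and down_mono: "j \<le> k \<Longrightarrow> down j \<le> down k"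
  by (simp_all add: clock_mono ones_mono zeros_mono)

lemma T_mono: "j \<le> k \<Longrightarrow> T j \<le> T k"
  using up_mono[of j k] down_mono[of j k] by (simp add: renewal_time_eq_clocks)

text \<open>
  Because the renewal times are monotone and the next one exceeds \<open>t\<close>, the set whose maximum is
  taken is exactly \<open>{1..n}\<close>, or empty if \<open>n = 0\<close>, where the definition has its own branch.
\<close>

lemma renewal_count_between:
  assumes "T n \<le> t" "t < T (Suc n)"
  shows "renewal_count X U D t \<omega> = n"
proof (cases n)
  case 0
  then show ?thesis using assms by (simp add: renewal_count_def)
next
  case (Suc j)
  have "{i. i \<ge> 1 \<and> T i \<le> t} = {1..n}"
  proof (intro equalityI subsetI CollectI conjI)
    fix i assume i: "i \<in> {i. i \<ge> 1 \<and> T i \<le> t}"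
    then have "\<not> Suc n \<le> i" using assms(2) T_mono[of "Suc n" i] by auto
    then show "i \<in> {1..n}" using i by simp
  next
    fix i assume "i \<in> {1..n}"
    then show "1 \<le> i" "T i \<le> t" using assms(1) T_mono[of i n] by auto
  qed
  moreover have "T 1 \<le> t" using T_mono[of 1 n] Suc assms by simp
  moreover have "Max {1..n} = n" using Suc by (intro Max_eqI) auto
  ultimately show ?thesis by (simp add: renewal_count_def)
qed

lemma V_has_integral_within_step:
  assumes "T n \<le> t" "t \<le> T (Suc n)"
  shows "(V has_integral (velocity_seq X c v n \<omega> * (t - T n))) {T n..t}"
proof -
  have "((\<lambda>_. velocity_seq X c v n \<omega>) has_integral (velocity_seq X c v n \<omega> * (t - T n))) (cbox (T n) t)"
    using assms has_integral_const_real[of "velocity_seq X c v n \<omega>" "T n" t] by (simp add: mult.commute)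
  moreover have "V u = velocity_seq X c v n \<omega>" if "u \<in> box (T n) t" for u
    using that assms(2) renewal_count_between[of n u] by (simp add: velocity_def)
  ultimately have "(V has_integral (velocity_seq X c v n \<omega> * (t - T n))) (cbox (T n) t)"
    by (rule has_integral_spike_interior)
  then show ?thesis by simp
qed

lemma V_has_integral_renewal_time:
  "(V has_integral (c * up n - v * down n)) {0..T n}"
proof (induction n)
  case (Suc n)
  have "0 \<le> T n" "T n \<le> T (Suc n)"
    using T_mono[of 0 n] T_mono[of n "Suc n"] by simp_all
  from has_integral_combine[OF this Suc V_has_integral_within_step]
  have "(V has_integral (c * up n - v * down n + velocity_seq X c v n \<omega> * (T (Suc n) - T n))) {0..T (Suc n)}"
    using \<open>T n \<le> T (Suc n)\<close> by simp
  moreover have "c * up n - v * down n + velocity_seq X c v n \<omega> * (T (Suc n) - T n)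
      = c * up (Suc n) - v * down (Suc n)"
    using binary[of "Suc n"] ones_le[of n]
    by (auto simp: renewal_time_eq_clocks velocity_seq_def Suc_diff_le algebra_simps)
  ultimately show ?case by simp
qed (simp add: has_integral_refl(2))

context
  assumes V_measurable: "V \<in> borel_measurable borel"
begin

lemma V_set_integrable: "set_integrable lborel {a..b} V"
proof (rule set_integrable_bound[where f="\<lambda>_. c + v"])
  have "norm (V t) \<le> norm (c + v)" for t
    using V_bounds[of t] speeds by (simp add: abs_le_iff)
  then show "AE t in lborel. t \<in> {a..b} \<longrightarrow> norm (V t) \<le> norm (c + v)" by simp
  show "set_borel_measurable lborel {a..b} V"
    using V_measurable unfolding set_borel_measurable_def by simp
  show "set_integrable lborel {a..b} (\<lambda>_. c + v)"
    using emeasure_bounded_finite[of "{a..b}"] by (simp add: set_integrable_def integrable_indicator_iff)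
qed

lemma V_integrable_on: "V integrable_on {a..b}"
  and position_eq_integral: "position X U D c v t \<omega> = integral {0..t} V"
  using set_borel_integral_eq_integral[OF V_set_integrable] by (simp_all add: position_def)

lemma V_integral_bounds:
  assumes "a \<le> b"
  shows "- v * (b - a) \<le> integral {a..b} V" "integral {a..b} V \<le> c * (b - a)"
proof -
  have "integral {a..b} (\<lambda>_. - v) \<le> integral {a..b} V"
    by (intro integral_le V_integrable_on) (auto simp: V_bounds)
  then show "- v * (b - a) \<le> integral {a..b} V" using assms by (simp add: mult.commute)
  have "integral {a..b} V \<le> integral {a..b} (\<lambda>_. c)"
    by (intro integral_le V_integrable_on) (auto simp: V_bounds)
  then show "integral {a..b} V \<le> c * (b - a)" using assms by (simp add: mult.commute)
qed

lemma position_split: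
  assumes "T n \<le> \<tau>" "\<tau> \<le> T (Suc n)" "\<tau> \<le> t"
  shows "position X U D c v t \<omega> =
    c * up n - v * down n + velocity_seq X c v n \<omega> * (\<tau> - T n) + integral {\<tau>..t} V"
proof -
  have "0 \<le> T n" using T_mono[of 0 n] by simp
  have "(V has_integral (c * up n - v * down n + velocity_seq X c v n \<omega> * (\<tau> - T n))) {0..\<tau>}"
    by (rule has_integral_combine[OF \<open>0 \<le> T n\<close> assms(1) V_has_integral_renewal_time
          V_has_integral_within_step[OF assms(1,2)]])
  then have "integral {0..\<tau>} V = c * up n - v * down n + velocity_seq X c v n \<omega> * (\<tau> - T n)"
    by (rule integral_unique)
  moreover have "integral {0..\<tau>} V + integral {\<tau>..t} V = integral {0..t} V"
    using \<open>0 \<le> T n\<close> assms by (intro Henstock_Kurzweil_Integration.integral_combine V_integrable_on) auto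
  ultimately show ?thesis by (simp add: position_eq_integral)
qed

text \<open>
  The staircase leaves \<open>[0, w] \<times> [0, z]\<close> through the right side during step \<open>n\<close>. If that step is
  still running at time \<open>w + z\<close>, then only \<open>down n \<le> z\<close> time units were spent going down. Otherwise
  at least \<open>w\<close> time units were spent going up before the step ended. In both cases the upward time
  at \<open>w + z\<close> is at least \<open>w\<close>.
\<close>

lemma position_ge:
  assumes "X (Suc n) \<omega> = 1" "up n \<le> w" "w \<le> up (Suc n)" "down n \<le> z"
  shows "c * w - v * z \<le> position X U D c v (w + z) \<omega>"
proof -
  have down: "down (Suc n) = down n" using assms(1) by simp
  have Tn: "T n = up n + down n" and TS: "T (Suc n) = up (Suc n) + down n"
    using down renewal_time_eq_clocks by metis+
  define \<tau> where "\<tau> = min (w + z) (T (Suc n))"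
  have \<tau>: "T n \<le> \<tau>" "\<tau> \<le> T (Suc n)" "\<tau> \<le> w + z"
    using assms Tn T_mono[of n "Suc n"] by (auto simp: \<tau>_def)
  have Z: "velocity_seq X c v n \<omega> = c" using assms(1) by (simp add: velocity_seq_def)
  have S: "position X U D c v (w + z) \<omega> \<ge> c * up n - v * down n + c * (\<tau> - T n) - v * (w + z - \<tau>)"
    using position_split[OF \<tau>] V_integral_bounds(1)[OF \<tau>(3)] Z by simp
  show ?thesis
  proof (cases "w + z \<le> T (Suc n)")
    case True
    have "(c + v) * down n \<le> (c + v) * z" using assms speeds by simp
    then show ?thesis using S True Tn by (simp add: \<tau>_def algebra_simps)
  next
    case False
    define a where "a = up (Suc n)"
    have "\<tau> = a + down n" using False unfolding \<tau>_def TS a_def by simp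
    moreover have "(c + v) * w \<le> (c + v) * a"
      using assms(3) speeds unfolding a_def by (intro mult_left_mono) auto
    ultimately show ?thesis using S unfolding Tn by (simp add: algebra_simps)
  qed
qed

text \<open>
  The mirror image of \<open>position_ge\<close>: the staircase leaves the rectangle through its top.
\<close>

lemma position_le:
  assumes "X (Suc n) \<omega> = 0" "up n \<le> w" "down n \<le> z" "z \<le> down (Suc n)"
  shows "position X U D c v (w + z) \<omega> \<le> c * w - v * z"
proof -
  have up: "up (Suc n) = up n" using assms(1) by simp
  have Tn: "T n = up n + down n" and TS: "T (Suc n) = up n + down (Suc n)"
    using up renewal_time_eq_clocks by metis+
  define \<tau> where "\<tau> = min (w + z) (T (Suc n))"
  have \<tau>: "T n \<le> \<tau>" "\<tau> \<le> T (Suc n)" "\<tau> \<le> w + z"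
    using assms Tn T_mono[of n "Suc n"] by (auto simp: \<tau>_def)
  have Z: "velocity_seq X c v n \<omega> = - v" using assms(1) by (simp add: velocity_seq_def)
  have S: "position X U D c v (w + z) \<omega> \<le> c * up n - v * down n - v * (\<tau> - T n) + c * (w + z - \<tau>)"
    using position_split[OF \<tau>] V_integral_bounds(2)[OF \<tau>(3)] Z by simp
  show ?thesis
  proof (cases "w + z \<le> T (Suc n)")
    case True
    have "(c + v) * up n \<le> (c + v) * w" using assms speeds by simp
    then show ?thesis using S True Tn by (simp add: \<tau>_def algebra_simps)
  next
    case False
    define d where "d = down (Suc n)"
    have "\<tau> = up n + d" using False unfolding \<tau>_def TS d_def by simp
    moreover have "(c + v) * z \<le> (c + v) * d"
      using assms(4) speeds unfolding d_def by (intro mult_left_mono) auto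
    ultimately show ?thesis using S unfolding Tn by (simp add: algebra_simps)
  qed
qed

end

end

section \<open>Recovering a law from its distribution function on an interval\<close>

text \<open>
  The missing inequality at \<open>x\<close> comes from nearby points, for instance
  \<open>measure N {..x} \<le> measure N {..<y} \<le> F y\<close> for \<open>y > x\<close>, where \<open>F y\<close> tends to \<open>F x\<close>.
  At \<open>a\<close> and at \<open>b\<close> there are such points on one side only, so atoms there remain possible.
\<close>

lemma cdf_eq_of_squeeze:
  fixes N :: "real measure" and F :: "real \<Rightarrow> real"
  assumes "prob_space N" and borel: "sets N = sets borel"
    and cont: "continuous_on {a..b} F"
    and lower: "\<And>x. x \<in> {a..b} \<Longrightarrow> F x \<le> measure N {..x}"
    and upper: "\<And>x. x \<in> {a..b} \<Longrightarrow> measure N {..<x} \<le> F x"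
  shows "x \<in> {a..<b} \<Longrightarrow> measure N {..x} = F x"
    and "x \<in> {a<..b} \<Longrightarrow> measure N {..<x} = F x"
proof -
  interpret prob_space N by fact
  note [simp] = borel
  show "measure N {..x} = F x" if x: "x \<in> {a..<b}"
  proof (rule antisym)
    have "continuous_on {x..b} F" using cont x by (auto intro: continuous_on_subset)
    then have "(F \<longlongrightarrow> F x) (at x within {x..b})" using x by (simp add: continuous_on_def)
    then have lim: "(F \<longlongrightarrow> F x) (at_right x)" using x by (simp add: at_within_Icc_at_right)
    have "\<forall>\<^sub>F y in at_right x. measure N {..x} \<le> F y"
    proof -
      have "measure N {..x} \<le> F y" if "x < y" "y < b" for y
      proof -
        have "measure N {..x} \<le> measure N {..<y}" using that by (intro finite_measure_mono) auto
        also have "\<dots> \<le> F y" using x that by (intro upper) auto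
        finally show ?thesis .
      qed
      then show ?thesis using x unfolding eventually_at_right_field by auto
    qed
    then show "measure N {..x} \<le> F x"
      by (intro tendsto_lowerbound[OF lim]) auto
  qed (use lower x in auto)
  show "measure N {..<x} = F x" if x: "x \<in> {a<..b}"
  proof (rule antisym)
    have "continuous_on {a..x} F" using cont x by (auto intro: continuous_on_subset)
    then have "(F \<longlongrightarrow> F x) (at x within {a..x})" using x by (simp add: continuous_on_def)
    then have lim: "(F \<longlongrightarrow> F x) (at_left x)" using x by (simp add: at_within_Icc_at_left)
    have "\<forall>\<^sub>F y in at_left x. F y \<le> measure N {..<x}"
    proof -
      have "F y \<le> measure N {..<x}" if "a < y" "y < x" for y
      proof -
        have "F y \<le> measure N {..y}" using x that by (intro lower) auto
        also have "\<dots> \<le> measure N {..<x}" using that by (intro finite_measure_mono) auto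
        finally show ?thesis .
      qed
      then show ?thesis using x unfolding eventually_at_left_field by auto
    qed
    then show "F x \<le> measure N {..<x}"
      by (intro tendsto_upperbound[OF lim]) auto
  qed (use upper x in auto)
qed

text \<open>
  The values of the distribution function identify \<open>N\<close> on the open interval with the measure of
  density \<open>f\<close>. What is left of \<open>N\<close> is carried by the two points \<open>a\<close> and \<open>b\<close>.
\<close>

lemma ac_component_density_of_cdf:
  fixes N :: "real measure" and F f :: "real \<Rightarrow> real"
  assumes "prob_space N" and borel: "sets N = sets borel" and "a < b"
    and outside: "emeasure N (- {a..b}) = 0"
    and cdf: "\<And>x. x \<in> {a..<b} \<Longrightarrow> measure N {..x} = F x" "measure N {..<b} = F b"
    and deriv: "\<And>x. (F has_real_derivative f x) (at x)"
    and f: "f \<in> borel_measurable borel" "\<And>x. 0 \<le> f x"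
  shows "ac_component_density N (\<lambda>x. if a < x \<and> x < b then f x else 0)"
proof -
  interpret prob_space N by fact
  note [simp] = borel
  note f(1)[measurable]
  define I where "I = {a<..<b}"
  define g where "g x = (if a < x \<and> x < b then f x else 0)" for x
  have g[measurable]: "g \<in> borel_measurable borel"
    unfolding g_def by measurable
  have restrict: "emeasure (density N (indicator E)) A = emeasure N (E \<inter> A)"
    if "E \<in> sets borel" "A \<in> sets borel" for E A
  proof -
    have "emeasure (density N (indicator E)) A = (\<integral>\<^sup>+x. indicator E x * indicator A x \<partial>N)"
      using that by (intro emeasure_density borel_measurable_indicator) simp_all
    then show ?thesis using that by (simp flip: indicator_inter_arith)
  qed
  have dens: "density N (indicator I) = density lborel g"
  proof (rule measure_eqI_lessThan)
    fix x :: real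
    show "emeasure (density N (indicator I)) {x<..} < \<infinity>"
      by (subst restrict) (auto simp: I_def less_top[symmetric])
    define y where "y = max a x"
    show "emeasure (density N (indicator I)) {x<..} = emeasure (density lborel g) {x<..}"
    proof (cases "y < b")
      case True
      have "emeasure (density N (indicator I)) {x<..} = emeasure N {y<..<b}"
        by (subst restrict) (auto simp: I_def y_def intro!: arg_cong[where f="emeasure N"])
      also have "{y<..<b} = {..<b} - {..y}" by auto
      also have "emeasure N ({..<b} - {..y}) = ennreal (measure N {..<b} - measure N {..y})"
        using True by (subst emeasure_eq_measure, subst finite_measure_Diff) auto
      also have "\<dots> = ennreal (F b - F y)"
        using cdf True by (simp add: y_def)
      also have "\<dots> = (\<integral>\<^sup>+u. ennreal (f u) * indicator {y..b} u \<partial>lborel)"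
        using True deriv f by (intro nn_integral_FTC_Icc[symmetric]) auto
      also have "\<dots> = (\<integral>\<^sup>+u. ennreal (g u) * indicator {x<..} u \<partial>lborel)"
      proof (rule nn_integral_cong_AE)
        \<comment> \<open>The two integrands may differ at the end points of the interval only.\<close>
        have "AE u in lborel. u \<noteq> y \<and> u \<noteq> b"
          using AE_lborel_singleton[of y] AE_lborel_singleton[of b] by eventually_elim simp
        then show "AE u in lborel. ennreal (f u) * indicator {y..b} u = ennreal (g u) * indicator {x<..} u"
          by eventually_elim (auto simp: g_def y_def indicator_def)
      qed
      also have "\<dots> = emeasure (density lborel g) {x<..}"
        by (subst emeasure_density) auto
      finally show ?thesis .
    next
      case False
      then have "I \<inter> {x<..} = {}" using \<open>a < b\<close> by (auto simp: I_def y_def)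
      then have "emeasure (density N (indicator I)) {x<..} = 0"
        using restrict[of I "{x<..}"] by (simp add: I_def)
      moreover have "(\<lambda>u. ennreal (g u) * indicator {x<..} u) = (\<lambda>_. 0)"
        using False \<open>a < b\<close> by (auto simp: g_def y_def indicator_def)
      then have "emeasure (density lborel g) {x<..} = 0"
        by (subst emeasure_density) (simp_all only: nn_integral_const mult_zero_left, simp_all)
      ultimately show ?thesis by simp
    qed
  qed simp_all
  show ?thesis
    unfolding ac_component_density_def
  proof (intro conjI exI[of _ "density N (indicator (- I))"] bexI[of _ "{a, b}"] ballI allI)
    show "(\<lambda>x. if a < x \<and> x < b then f x else 0) \<in> borel_measurable borel" by measurable
    show "0 \<le> (if a < x \<and> x < b then f x else 0)" for x using f(2) by simp
    show "sets (density N (indicator (- I))) = sets borel" by simp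
    show "{a, b} \<in> null_sets lborel" by (auto intro: finite_imp_null_set_lborel)
    have "- I \<inter> - {a, b} = - {a..b}" using \<open>a < b\<close> by (auto simp: I_def)
    then show "emeasure (density N (indicator (- I))) (- {a, b}) = 0"
      using outside by (subst restrict) (auto simp: I_def)
    fix A :: "real set" assume A: "A \<in> sets borel"
    have "emeasure N A = emeasure N (I \<inter> A) + emeasure N (- I \<inter> A)"
      using A by (subst plus_emeasure) (auto simp: I_def intro!: arg_cong[where f="emeasure N"])
    also have "emeasure N (I \<inter> A) = emeasure (density lborel g) A"
      using A restrict[of I A] unfolding dens by (simp add: I_def)
    also have "emeasure N (- I \<inter> A) = emeasure (density N (indicator (- I))) A"
      using A by (subst restrict) (auto simp: I_def)
    finally show "emeasure N A = emeasure (density lborel (\<lambda>x. if a < x \<and> x < b then f x else 0)) A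
        + emeasure (density N (indicator (- I))) A"
      by (simp add: g_def[abs_def])
  qed
qed


section \<open>The logistic distribution\<close>

definition logistic_cdf :: "real \<Rightarrow> real \<Rightarrow> real \<Rightarrow> real" where
  "logistic_cdf m s x = 1 / (1 + exp (- (x - m) / s))"

definition logistic_density :: "real \<Rightarrow> real \<Rightarrow> real \<Rightarrow> real" where
  "logistic_density m s x = exp (- (x - m) / s) / (s * (1 + exp (- (x - m) / s))\<^sup>2)"

lemma logistic_cdf_has_derivative:
  assumes "s \<noteq> 0"
  shows "(logistic_cdf m s has_real_derivative logistic_density m s x) (at x)"
proof -
  have "1 + exp (- (x - m) / s) \<noteq> 0" by (metis add_pos_pos exp_gt_zero less_irrefl zero_less_one)
  then show ?thesis
    unfolding logistic_cdf_def[abs_def] logistic_density_def using assms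
    by (auto intro!: derivative_eq_intros simp: power2_eq_square field_simps)
qed

lemma logistic_density_measurable: "logistic_density m s \<in> borel_measurable borel"
  unfolding logistic_density_def[abs_def] by measurable

lemma logistic_density_nonneg: "0 < s \<Longrightarrow> 0 \<le> logistic_density m s x"
  by (simp add: logistic_density_def)


section \<open>Measurability of the position\<close>

locale linear_rate_telegraph = bernoulli_telegraph M X U D c v b r
  for M :: "'a measure" and X :: "nat \<Rightarrow> 'a \<Rightarrow> nat" and U D :: "nat \<Rightarrow> 'a \<Rightarrow> real" and c v b r :: real +
  fixes lam mu p :: real
  assumes rates_pos: "0 < lam" "0 < mu"
    and U_exp: "\<And>k. k \<ge> 1 \<Longrightarrow> distributed M lborel (U k) (exponential_density (lam * real k))"
    and D_exp: "\<And>k. k \<ge> 1 \<Longrightarrow> distributed M lborel (D k) (exponential_density (mu * real k))"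
    and p_def: "p = b / (b + r)"
begin

lemma p_bounds: "0 < p" "p < 1"
  using b_pos r_pos by (simp_all add: p_def)

lemma X_measurable [measurable]: "X (Suc n) \<in> measurable M (count_space UNIV)"
  using X_rv by simp

lemma U_measurable [measurable]: "U (Suc k) \<in> borel_measurable M"
  using distributed_measurable[OF U_exp[of "Suc k"]] by simp

lemma D_measurable [measurable]: "D (Suc k) \<in> borel_measurable M"
  using distributed_measurable[OF D_exp[of "Suc k"]] by simp

lemma clock_U_measurable [measurable]: "clock U k \<in> borel_measurable M"
  by (induction k) (simp_all add: clock_def[abs_def])

lemma clock_D_measurable [measurable]: "clock D k \<in> borel_measurable M"
  by (induction k) (simp_all add: clock_def[abs_def])

lemma ones_measurable [measurable]: "ones X n \<in> measurable M (count_space UNIV)"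
proof (induction n)
  case (Suc n)
  note Suc[measurable]
  have "(\<lambda>\<omega>. ones X n \<omega> + X (Suc n) \<omega>) \<in> measurable M (count_space UNIV)" by measurable
  then show ?case by simp
qed (simp add: ones_def[abs_def])

lemma clock_U_random_index [measurable]:
  "N \<in> measurable M (count_space UNIV) \<Longrightarrow> (\<lambda>\<omega>. clock U (N \<omega>) \<omega>) \<in> borel_measurable M"
  by (rule measurable_compose_countable) measurable

lemma clock_D_random_index [measurable]:
  "N \<in> measurable M (count_space UNIV) \<Longrightarrow> (\<lambda>\<omega>. clock D (N \<omega>) \<omega>) \<in> borel_measurable M"
  by (rule measurable_compose_countable) measurable

lemma path: "\<omega> \<in> space M \<Longrightarrow> telegraph_path X \<omega>"
  using X_binary by unfold_locales

lemma renewal_time_measurable [measurable]: "renewal_time X U D n \<in> borel_measurable M"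
proof -
  have "(\<lambda>\<omega>. clock U (ones X n \<omega>) \<omega> + clock D (n - ones X n \<omega>) \<omega>) \<in> borel_measurable M"
    by measurable
  then show ?thesis
    by (rule measurable_cong[THEN iffD2, rotated])
      (simp add: telegraph_path.renewal_time_eq_clocks[OF path])
qed

text \<open>
  Joint measurability makes the position, an integral over time, a random variable. It also makes
  each velocity path measurable.
\<close>

lemma velocity_measurable_pair:
  "(\<lambda>(\<omega>, u). velocity X U D c v u \<omega>) \<in> borel_measurable (M \<Otimes>\<^sub>M borel)"
proof -
  have [measurable]: "(\<lambda>q. renewal_count X U D (snd q) (fst q)) \<in> measurable (M \<Otimes>\<^sub>M borel) (count_space UNIV)"
    unfolding renewal_count_def by measurable
  have "(\<lambda>q. velocity_seq X c v (renewal_count X U D (snd q) (fst q)) (fst q)) \<in> borel_measurable (M \<Otimes>\<^sub>M borel)"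
    by (rule measurable_compose_countable[where g="\<lambda>q. renewal_count X U D (snd q) (fst q)"])
      (simp_all add: velocity_seq_def)
  then show ?thesis by (simp add: velocity_def case_prod_beta)
qed

lemma velocity_measurable: "\<omega> \<in> space M \<Longrightarrow> (\<lambda>u. velocity X U D c v u \<omega>) \<in> borel_measurable borel"
  using measurable_compose[OF measurable_Pair1' velocity_measurable_pair] by simp

lemma position_measurable [measurable]: "position X U D c v t \<in> borel_measurable M"
proof -
  have "(\<lambda>(\<omega>, u). velocity X U D c v u \<omega>) \<in> borel_measurable (M \<Otimes>\<^sub>M lborel)"
    using velocity_measurable_pair by (simp cong: measurable_cong_sets sets_pair_measure_cong)
  then have "(\<lambda>(\<omega>, u). indicator {0..t} u *\<^sub>R velocity X U D c v u \<omega>) \<in> borel_measurable (M \<Otimes>\<^sub>M lborel)"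
    unfolding case_prod_beta by measurable
  then show ?thesis
    unfolding position_def[abs_def] set_lebesgue_integral_def
    by (rule lborel.borel_measurable_lebesgue_integral)
qed


section \<open>The clocks observed at the trials\<close>

text \<open>
  The almost sure event on which both clocks are monotone, so that the deterministic statements
  about paths apply.
\<close>

definition regular :: "'a set" where
  "regular = {\<omega> \<in> space M. \<forall>k. 0 \<le> U (Suc k) \<omega> \<and> 0 \<le> D (Suc k) \<omega>}"

lemma AE_regular: "AE \<omega> in M. \<omega> \<in> regular"
proof -
  have "AE \<omega> in M. \<forall>k. 0 \<le> U (Suc k) \<omega> \<and> 0 \<le> D (Suc k) \<omega>"
    using U_nonneg D_nonneg by (simp add: AE_all_countable AE_conj_iff)
  then show ?thesis using AE_space by eventually_elim (simp add: regular_def)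
qed

lemma regular_measurable [measurable]: "regular \<in> events"
  unfolding regular_def by measurable

lemma regular_path: "\<omega> \<in> regular \<Longrightarrow> nonneg_telegraph_path X U D \<omega> c v"
  using X_binary c_pos v_pos
  by unfold_locales (auto simp: regular_def Suc_le_eq gr0_conv_Suc)

lemma indep_U: "indep_vars (\<lambda>_. borel) U {1..}"
proof -
  have "indep_vars (\<lambda>_. borel)
     (\<lambda>j \<omega>. \<Sum>i\<in>{Inr (Inl j)}. case_sum (\<lambda>n \<omega>. real (X n \<omega>)) (case_sum U D) i \<omega>) {1..}"
    by (rule indep_vars_block_sums[OF indep]) (auto simp: disjoint_family_on_def)
  then show ?thesis by simp
qed

lemma indep_D: "indep_vars (\<lambda>_. borel) D {1..}"
proof -
  have "indep_vars (\<lambda>_. borel)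
     (\<lambda>j \<omega>. \<Sum>i\<in>{Inr (Inr j)}. case_sum (\<lambda>n \<omega>. real (X n \<omega>)) (case_sum U D) i \<omega>) {1..}"
    by (rule indep_vars_block_sums[OF indep]) (auto simp: disjoint_family_on_def)
  then show ?thesis by simp
qed

lemma clock_U_cdf: "0 \<le> w \<Longrightarrow> prob {\<omega> \<in> space M. clock U k \<omega> \<le> w} = (1 - exp (- (lam * w))) ^ k"
  unfolding clock_def using linear_rate_partial_sum_cdf[OF indep_U U_exp] rates_pos by simp

lemma clock_D_cdf: "0 \<le> w \<Longrightarrow> prob {\<omega> \<in> space M. clock D k \<omega> \<le> w} = (1 - exp (- (mu * w))) ^ k"
  unfolding clock_def using linear_rate_partial_sum_cdf[OF indep_D D_exp] rates_pos by simp

text \<open>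
  The set \<open>S\<close> encodes a word: the outcomes of the first \<open>m\<close> trials are 1 exactly on \<open>S\<close>. For fixed
  \<open>k\<close> and \<open>l\<close> the single trials and the two clocks are sums over disjoint blocks of the independent
  family of the model.
\<close>

lemma prob_word_and_clocks:
  assumes "S \<subseteq> {1..m}" "0 \<le> w" "0 \<le> z"
  shows "prob {\<omega> \<in> space M. (\<forall>i\<in>{1..m}. X i \<omega> = of_bool (i \<in> S)) \<and> clock U k \<omega> \<le> w \<and> clock D l \<omega> \<le> z}
    = p ^ card S * (1 - p) ^ (m - card S) * (1 - exp (- (lam * w))) ^ k * (1 - exp (- (mu * z))) ^ l"
proof -
  let ?J = "{1..m} <+> (UNIV :: bool set)"
  let ?fam = "case_sum (\<lambda>n \<omega>. real (X n \<omega>)) (case_sum U D)"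
  define K :: "nat + bool \<Rightarrow> (nat + nat + nat) set" where
    "K = case_sum (\<lambda>n. {Inl n}) (\<lambda>up. if up then Inr ` Inl ` {1..k} else Inr ` Inr ` {1..l})"
  define B :: "nat + bool \<Rightarrow> real set" where
    "B = case_sum (\<lambda>i. {of_bool (i \<in> S)}) (\<lambda>up. if up then {..w} else {..z})"
  define Y where "Y j \<omega> = (\<Sum>i\<in>K j. ?fam i \<omega>)" for j \<omega>
  have Y: "Y (Inl i) = (\<lambda>\<omega>. real (X i \<omega>))" "Y (Inr True) = clock U k" "Y (Inr False) = clock D l" for i
    by (simp_all add: Y_def[abs_def] K_def fun_eq_iff clock_def sum.reindex image_image inj_on_def)
  have ind: "indep_vars (\<lambda>_. borel) Y ?J"
    unfolding Y_def[abs_def]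
    by (rule indep_vars_block_sums[OF indep])
      (auto simp: K_def disjoint_family_on_def split: sum.splits if_splits)
  have "prob (\<Inter>j\<in>?J. Y j -` B j \<inter> space M) = (\<Prod>j\<in>?J. prob (Y j -` B j \<inter> space M))"
    by (rule indep_varsD_finite[OF ind]) (auto simp: B_def split: sum.split)
  also have "(\<Inter>j\<in>?J. Y j -` B j \<inter> space M) =
    {\<omega> \<in> space M. (\<forall>i\<in>{1..m}. X i \<omega> = of_bool (i \<in> S)) \<and> clock U k \<omega> \<le> w \<and> clock D l \<omega> \<le> z}"
    by (auto simp: Plus_def UNIV_bool Y B_def of_bool_def split: if_splits)
  also have "(\<Prod>j\<in>?J. prob (Y j -` B j \<inter> space M)) =
     (\<Prod>i\<in>{1..m}. if i \<in> S then p else 1 - p) * ((1 - exp (- (lam * w))) ^ k * (1 - exp (- (mu * z))) ^ l)"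
  proof -
    have "prob (Y (Inl i) -` B (Inl i) \<inter> space M) = (if i \<in> S then p else 1 - p)" if "i \<in> {1..m}" for i
    proof -
      have "Y (Inl i) -` B (Inl i) \<inter> space M = {\<omega> \<in> space M. X i \<omega> = (if i \<in> S then 1 else 0)}"
        by (auto simp: Y B_def)
      then show ?thesis using X_one[of i] X_zero[of i] that by (simp add: p_def)
    qed
    moreover have "prob (Y (Inr True) -` B (Inr True) \<inter> space M) = (1 - exp (- (lam * w))) ^ k"
      using clock_U_cdf[OF assms(2), of k] by (simp add: Y B_def vimage_def Int_def conj_commute)
    moreover have "prob (Y (Inr False) -` B (Inr False) \<inter> space M) = (1 - exp (- (mu * z))) ^ l"
      using clock_D_cdf[OF assms(3), of l] by (simp add: Y B_def vimage_def Int_def conj_commute)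
    ultimately show ?thesis
      by (simp add: prod.Plus UNIV_bool mult.commute)
  qed
  also have "(\<Prod>i\<in>{1..m}. if i \<in> S then p else 1 - p) = p ^ card S * (1 - p) ^ (m - card S)"
  proof -
    have "{1..m} \<inter> {i. i \<in> S} = S" "{1..m} \<inter> - {i. i \<in> S} = {1..m} - S" using assms by auto
    moreover have "card ({1..m} - S) = m - card S"
      using assms(1) by (simp add: card_Diff_subset finite_subset)
    ultimately show ?thesis by (subst prod.If_cases) simp_all
  qed
  finally show ?thesis by (simp add: mult.assoc)
qed

text \<open>
  The clocks are now read at the random indices given by the trials. Splitting by the word of the
  first \<open>n\<close> trials makes the indices constant, and summing over all words, that is, over all
  subsets of \<open>{1..n}\<close>, multiplies out the power \<open>(p * A + (1 - p) * B) ^ n\<close>. The shifts \<open>i\<close> and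
  \<open>j\<close> allow the duration of the next step to be included.
\<close>

lemma prob_clocks_before_trial:
  assumes "e \<in> {0, 1}" "0 \<le> w" "0 \<le> z"
  shows "prob {\<omega> \<in> space M. X (Suc n) \<omega> = e \<and> clock U (ones X n \<omega> + i) \<omega> \<le> w
      \<and> clock D (n - ones X n \<omega> + j) \<omega> \<le> z}
    = (if e = 1 then p else 1 - p) * (1 - exp (- (lam * w))) ^ i * (1 - exp (- (mu * z))) ^ j
      * (p * (1 - exp (- (lam * w))) + (1 - p) * (1 - exp (- (mu * z)))) ^ n"
proof -
  define A where "A = 1 - exp (- (lam * w))"
  define B where "B = 1 - exp (- (mu * z))"
  define q where "q = (if e = 1 then p else 1 - p)"
  define W where "W S = {\<omega> \<in> space M. (\<forall>i\<in>{1..n}. X i \<omega> = of_bool (i \<in> S)) \<and> X (Suc n) \<omega> = e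
      \<and> clock U (card S + i) \<omega> \<le> w \<and> clock D (n - card S + j) \<omega> \<le> z}" for S
  have ones: "ones X n \<omega> = card S" if "S \<subseteq> {1..n}" "\<forall>i\<in>{1..n}. X i \<omega> = of_bool (i \<in> S)" for S \<omega>
  proof -
    have "ones X n \<omega> = (\<Sum>i\<in>{1..n}. of_bool (i \<in> S))"
      unfolding ones_def using that(2) by (intro sum.cong) auto
    also have "\<dots> = card S"
      using that(1) by (simp add: Int_absorb1 flip: Int_def)
    finally show ?thesis .
  qed
  have W_prob: "W S \<in> events \<and> prob (W S) = q * A ^ i * B ^ j * ((p * A) ^ card S * ((1 - p) * B) ^ (n - card S))"
    if S: "S \<subseteq> {1..n}" for S
  proof -
    \<comment> \<open>The word of length \<open>Suc n\<close> obtained by appending \<open>e\<close>.\<close>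
    define S' where "S' = (if e = 1 then insert (Suc n) S else S)"
    have fin: "finite S" "Suc n \<notin> S" "card S \<le> n"
      using S card_mono[OF _ S] by (auto intro: finite_subset)
    have S': "S' \<subseteq> {1..Suc n}" using S by (auto simp: S'_def)
    have W_eq: "W S = {\<omega> \<in> space M. (\<forall>i\<in>{1..Suc n}. X i \<omega> = of_bool (i \<in> S'))
        \<and> clock U (card S + i) \<omega> \<le> w \<and> clock D (n - card S + j) \<omega> \<le> z}"
      using assms(1) fin by (auto simp: W_def S'_def atLeastAtMostSuc_conv)
    have "prob (W S) = p ^ card S' * (1 - p) ^ (Suc n - card S') * A ^ (card S + i) * B ^ (n - card S + j)"
      unfolding W_eq A_def B_def by (rule prob_word_and_clocks[OF S' assms(2,3)])
    moreover have "p ^ card S' * (1 - p) ^ (Suc n - card S') = q * (p ^ card S * (1 - p) ^ (n - card S))"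
      using fin assms(1) by (auto simp: S'_def q_def Suc_diff_le)
    moreover have "W S \<in> events"
    proof -
      have "{\<omega> \<in> space M. \<forall>i\<in>{1..n}. X i \<omega> = of_bool (i \<in> S)} \<in> events"
        using X_rv by (intro sets.sets_Collect_finite_All) auto
      moreover have "W S = {\<omega> \<in> space M. \<forall>i\<in>{1..n}. X i \<omega> = of_bool (i \<in> S)} \<inter> {\<omega> \<in> space M. X (Suc n) \<omega> = e
        \<and> clock U (card S + i) \<omega> \<le> w \<and> clock D (n - card S + j) \<omega> \<le> z}" by (auto simp: W_def)
      ultimately show ?thesis by simp
    qed
    ultimately show ?thesis by (simp add: power_add power_mult_distrib mult_ac)
  qed
  have "{\<omega> \<in> space M. X (Suc n) \<omega> = e \<and> clock U (ones X n \<omega> + i) \<omega> \<le> w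
      \<and> clock D (n - ones X n \<omega> + j) \<omega> \<le> z} = (\<Union>S\<in>Pow {1..n}. W S)" (is "?E = _")
  proof (intro equalityI subsetI)
    fix \<omega> assume \<omega>: "\<omega> \<in> ?E"
    define S where "S = {i \<in> {1..n}. X i \<omega> = 1}"
    have S: "S \<subseteq> {1..n}" by (auto simp: S_def)
    moreover have word: "\<forall>i\<in>{1..n}. X i \<omega> = of_bool (i \<in> S)"
      using X_binary[of _ \<omega>] \<omega> unfolding S_def by fastforce
    ultimately have "\<omega> \<in> W S" using \<omega> ones[OF S word] by (simp add: W_def)
    then show "\<omega> \<in> (\<Union>S\<in>Pow {1..n}. W S)" using S by blast
  next
    fix \<omega> assume "\<omega> \<in> (\<Union>S\<in>Pow {1..n}. W S)"
    then obtain S where "S \<subseteq> {1..n}" "\<omega> \<in> W S" by auto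
    then show "\<omega> \<in> ?E" using ones[of S \<omega>] by (simp add: W_def)
  qed
  moreover have "prob (\<Union>S\<in>Pow {1..n}. W S) = (\<Sum>S\<in>Pow {1..n}. prob (W S))"
  proof (rule finite_measure_finite_Union)
    show "disjoint_family_on W (Pow {1..n})"
      unfolding disjoint_family_on_def
    proof (intro ballI impI equals0I)
      fix S S' \<omega> assume "S \<in> Pow {1..n}" "S' \<in> Pow {1..n}" "S \<noteq> S'" "\<omega> \<in> W S \<inter> W S'"
      then have "i \<in> S \<longleftrightarrow> i \<in> S'" for i
        by (cases "i \<in> {1..n}") (auto simp: W_def of_bool_def split: if_splits)
      then show False using \<open>S \<noteq> S'\<close> by auto
    qed
  qed (use W_prob in auto)
  moreover have "(\<Sum>S\<in>Pow {1..n}. prob (W S)) = q * A ^ i * B ^ j * (p * A + (1 - p) * B) ^ n"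
  proof -
    have "(\<Sum>S\<in>Pow {1..n}. prob (W S)) =
      q * A ^ i * B ^ j * (\<Sum>S\<in>Pow {1..n}. (\<Prod>x\<in>S. p * A) * (\<Prod>x\<in>{1..n} - S. (1 - p) * B))"
      unfolding sum_distrib_left
      by (intro sum.cong) (auto simp: W_prob card_Diff_subset finite_subset)
    also have "\<dots> = q * A ^ i * B ^ j * (p * A + (1 - p) * B) ^ n"
      by (subst prod_add[symmetric]) simp_all
    finally show ?thesis .
  qed
  ultimately show ?thesis by (simp add: q_def A_def B_def)
qed

section \<open>Where the staircase leaves a rectangle\<close>

text \<open>
  On \<open>exit_right w z n\<close> the staircase leaves \<open>[0, w] \<times> [0, z]\<close> through the right side during step
  \<open>n\<close>, on \<open>exit_top w z n\<close> through the top.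
\<close>

definition exit_right :: "real \<Rightarrow> real \<Rightarrow> nat \<Rightarrow> 'a set" where
  "exit_right w z n = {\<omega> \<in> regular. X (Suc n) \<omega> = 1 \<and> clock U (ones X n \<omega>) \<omega> \<le> w
      \<and> w < clock U (Suc (ones X n \<omega>)) \<omega> \<and> clock D (n - ones X n \<omega>) \<omega> \<le> z}"

definition exit_top :: "real \<Rightarrow> real \<Rightarrow> nat \<Rightarrow> 'a set" where
  "exit_top w z n = {\<omega> \<in> regular. X (Suc n) \<omega> = 0 \<and> clock U (ones X n \<omega>) \<omega> \<le> w
      \<and> clock D (n - ones X n \<omega>) \<omega> \<le> z \<and> z < clock D (Suc (n - ones X n \<omega>)) \<omega>}"

lemma regular_subset: "regular \<subseteq> space M"
  by (auto simp: regular_def)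

lemma exit_right_measurable [measurable]: "exit_right w z n \<in> events"
proof -
  have "exit_right w z n = regular \<inter> {\<omega> \<in> space M. X (Suc n) \<omega> = 1 \<and> clock U (ones X n \<omega>) \<omega> \<le> w
      \<and> w < clock U (Suc (ones X n \<omega>)) \<omega> \<and> clock D (n - ones X n \<omega>) \<omega> \<le> z}"
    using regular_subset by (auto simp: exit_right_def)
  then show ?thesis by (simp del: clock_Suc)
qed

lemma exit_top_measurable [measurable]: "exit_top w z n \<in> events"
proof -
  have "exit_top w z n = regular \<inter> {\<omega> \<in> space M. X (Suc n) \<omega> = 0 \<and> clock U (ones X n \<omega>) \<omega> \<le> w
      \<and> clock D (n - ones X n \<omega>) \<omega> \<le> z \<and> z < clock D (Suc (n - ones X n \<omega>)) \<omega>}"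
    using regular_subset by (auto simp: exit_top_def)
  then show ?thesis by (simp del: clock_Suc)
qed

text \<open>
  The conditional probability that the next step stays in the rectangle, given that all previous
  ones did.
\<close>

definition survival :: "real \<Rightarrow> real \<Rightarrow> real" where
  "survival w z = p * (1 - exp (- (lam * w))) + (1 - p) * (1 - exp (- (mu * z)))"

text \<open>
  Step \<open>n\<close> is horizontal and starts in the rectangle on \<open>G 0\<close>; it also ends there on \<open>G 1\<close>. The
  difference of these events is the exit.
\<close>

lemma prob_exit_right:
  assumes "0 \<le> w" "0 \<le> z"
  shows "prob (exit_right w z n) = p * exp (- (lam * w)) * survival w z ^ n"
proof -
  define G where "G i = {\<omega> \<in> space M. X (Suc n) \<omega> = 1 \<and> clock U (ones X n \<omega> + i) \<omega> \<le> w
      \<and> clock D (n - ones X n \<omega> + 0) \<omega> \<le> z}" for i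
  have [measurable]: "G i \<in> events" for i unfolding G_def by measurable
  have mono: "clock U k \<omega> \<le> a" if "clock U (Suc k) \<omega> \<le> a" "\<omega> \<in> regular" for \<omega> k a
    using that by (simp add: regular_def) (smt (verit, best))
  have "prob (exit_right w z n) = prob (G 0 - G 1)"
  proof (rule finite_measure_eq_AE)
    show "AE \<omega> in M. \<omega> \<in> exit_right w z n \<longleftrightarrow> \<omega> \<in> G 0 - G 1"
      using AE_regular by eventually_elim (use regular_subset in \<open>auto simp: exit_right_def G_def not_le simp del: clock_Suc\<close>)
  qed measurable
  also have "\<dots> = prob (G 0) - prob (G 0 \<inter> G 1)"
    by (rule finite_measure_Diff') measurable
  also have "prob (G 0 \<inter> G 1) = prob (G 1)"
  proof (rule finite_measure_eq_AE)
    show "AE \<omega> in M. \<omega> \<in> G 0 \<inter> G 1 \<longleftrightarrow> \<omega> \<in> G 1"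
      using AE_regular by eventually_elim (auto simp: G_def simp del: clock_Suc intro: mono)
  qed measurable
  also have "prob (G 0) - prob (G 1) = p * exp (- (lam * w)) * survival w z ^ n"
    using prob_clocks_before_trial[of 1 w z n 0 0] prob_clocks_before_trial[of 1 w z n 1 0] assms
    unfolding G_def survival_def by (simp add: algebra_simps)
  finally show ?thesis .
qed

lemma prob_exit_top:
  assumes "0 \<le> w" "0 \<le> z"
  shows "prob (exit_top w z n) = (1 - p) * exp (- (mu * z)) * survival w z ^ n"
proof -
  define G where "G j = {\<omega> \<in> space M. X (Suc n) \<omega> = 0 \<and> clock U (ones X n \<omega> + 0) \<omega> \<le> w
      \<and> clock D (n - ones X n \<omega> + j) \<omega> \<le> z}" for j
  have [measurable]: "G i \<in> events" for i unfolding G_def by measurable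
  have mono: "clock D k \<omega> \<le> a" if "clock D (Suc k) \<omega> \<le> a" "\<omega> \<in> regular" for \<omega> k a
    using that by (simp add: regular_def) (smt (verit, best))
  have "prob (exit_top w z n) = prob (G 0 - G 1)"
  proof (rule finite_measure_eq_AE)
    show "AE \<omega> in M. \<omega> \<in> exit_top w z n \<longleftrightarrow> \<omega> \<in> G 0 - G 1"
      using AE_regular by eventually_elim (use regular_subset in \<open>auto simp: exit_top_def G_def not_le simp del: clock_Suc\<close>)
  qed measurable
  also have "\<dots> = prob (G 0) - prob (G 0 \<inter> G 1)"
    by (rule finite_measure_Diff') measurable
  also have "prob (G 0 \<inter> G 1) = prob (G 1)"
  proof (rule finite_measure_eq_AE)
    show "AE \<omega> in M. \<omega> \<in> G 0 \<inter> G 1 \<longleftrightarrow> \<omega> \<in> G 1"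
      using AE_regular by eventually_elim (auto simp: G_def simp del: clock_Suc intro: mono)
  qed measurable
  also have "prob (G 0) - prob (G 1) = (1 - p) * exp (- (mu * z)) * survival w z ^ n"
    using prob_clocks_before_trial[of 0 w z n 0 0] prob_clocks_before_trial[of 0 w z n 0 1] assms
    unfolding G_def survival_def by (simp add: algebra_simps)
  finally show ?thesis .
qed

lemma disjoint_exit_right: "disjoint_family (exit_right w z)"
proof -
  have "exit_right w z n \<inter> exit_right w z n' = {}" if "n < n'" for n n'
  proof (rule equals0I)
    fix \<omega> assume \<omega>: "\<omega> \<in> exit_right w z n \<inter> exit_right w z n'"
    interpret nonneg_telegraph_path X U D \<omega> c v
      using \<omega> by (intro regular_path) (simp add: exit_right_def)
    have "up (Suc n) \<le> up n'" using that by (intro up_mono) simp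
    then show False using \<omega> by (simp add: exit_right_def)
  qed
  then show ?thesis
    unfolding disjoint_family_on_def by (metis Int_commute nat_neq_iff)
qed

lemma disjoint_exit_top: "disjoint_family (exit_top w z)"
proof -
  have "exit_top w z n \<inter> exit_top w z n' = {}" if "n < n'" for n n'
  proof (rule equals0I)
    fix \<omega> assume \<omega>: "\<omega> \<in> exit_top w z n \<inter> exit_top w z n'"
    interpret nonneg_telegraph_path X U D \<omega> c v
      using \<omega> by (intro regular_path) (simp add: exit_top_def)
    have "down (Suc n) \<le> down n'" using that by (intro down_mono) simp
    then show False using \<omega> ones_le[of n] by (simp add: exit_top_def Suc_diff_le)
  qed
  then show ?thesis
    unfolding disjoint_family_on_def by (metis Int_commute nat_neq_iff)
qed

lemma survival_bounds:
  assumes "0 \<le> w" "0 \<le> z"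
  shows "0 \<le> survival w z" "survival w z < 1"
proof -
  show "0 \<le> survival w z"
    using p_bounds rates_pos assms unfolding survival_def
    by (intro add_nonneg_nonneg mult_nonneg_nonneg) auto
  have "0 < p * exp (- (lam * w)) + (1 - p) * exp (- (mu * z))"
    using p_bounds by (intro add_pos_pos mult_pos_pos) auto
  then show "survival w z < 1"
    unfolding survival_def by (simp add: algebra_simps)
qed

lemma geometric_survival_sums:
  assumes "0 \<le> w" "0 \<le> z"
  shows "(\<lambda>n. a * survival w z ^ n) sums (a / (p * exp (- (lam * w)) + (1 - p) * exp (- (mu * z))))"
proof -
  have "(\<lambda>n. a * survival w z ^ n) sums (a * (1 / (1 - survival w z)))"
    using survival_bounds[OF assms] by (intro sums_mult geometric_sums) simp
  moreover have "1 - survival w z = p * exp (- (lam * w)) + (1 - p) * exp (- (mu * z))"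
    by (simp add: survival_def algebra_simps)
  ultimately show ?thesis by simp
qed

lemma prob_position_ge:
  assumes "0 \<le> w" "0 \<le> z"
  shows "p * exp (- (lam * w)) / (p * exp (- (lam * w)) + (1 - p) * exp (- (mu * z)))
    \<le> prob {\<omega> \<in> space M. c * w - v * z \<le> position X U D c v (w + z) \<omega>}"
proof -
  have "(\<lambda>n. prob (exit_right w z n)) sums prob (\<Union>n. exit_right w z n)"
    by (intro finite_measure_UNION disjoint_exit_right) auto
  then have "prob (\<Union>n. exit_right w z n) =
      p * exp (- (lam * w)) / (p * exp (- (lam * w)) + (1 - p) * exp (- (mu * z)))"
    unfolding prob_exit_right[OF assms] using geometric_survival_sums[OF assms] sums_unique2 by blast
  moreover
  have "(\<Union>n. exit_right w z n) \<subseteq>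
      {\<omega> \<in> space M. c * w - v * z \<le> position X U D c v (w + z) \<omega>}"
  proof safe
    fix n \<omega> assume \<omega>: "\<omega> \<in> exit_right w z n"
    then have reg: "\<omega> \<in> regular" by (simp add: exit_right_def)
    then show sp: "\<omega> \<in> space M" using regular_subset by auto
    interpret nonneg_telegraph_path X U D \<omega> c v by (rule regular_path[OF reg])
    show "c * w - v * z \<le> position X U D c v (w + z) \<omega>"
      by (rule position_ge[OF velocity_measurable[OF sp], of n]) (use \<omega> in \<open>auto simp: exit_right_def\<close>)
  qed
  then have "prob (\<Union>n. exit_right w z n) \<le> prob {\<omega> \<in> space M. c * w - v * z \<le> position X U D c v (w + z) \<omega>}"
    by (rule finite_measure_mono) measurable
  ultimately show ?thesis by simp
qed

lemma prob_position_le: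
  assumes "0 \<le> w" "0 \<le> z"
  shows "(1 - p) * exp (- (mu * z)) / (p * exp (- (lam * w)) + (1 - p) * exp (- (mu * z)))
    \<le> prob {\<omega> \<in> space M. position X U D c v (w + z) \<omega> \<le> c * w - v * z}"
proof -
  have "(\<lambda>n. prob (exit_top w z n)) sums prob (\<Union>n. exit_top w z n)"
    by (intro finite_measure_UNION disjoint_exit_top) auto
  then have "prob (\<Union>n. exit_top w z n) =
      (1 - p) * exp (- (mu * z)) / (p * exp (- (lam * w)) + (1 - p) * exp (- (mu * z)))"
    unfolding prob_exit_top[OF assms] using geometric_survival_sums[OF assms] sums_unique2 by blast
  moreover
  have "(\<Union>n. exit_top w z n) \<subseteq>
      {\<omega> \<in> space M. position X U D c v (w + z) \<omega> \<le> c * w - v * z}"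
  proof safe
    fix n \<omega> assume \<omega>: "\<omega> \<in> exit_top w z n"
    then have reg: "\<omega> \<in> regular" by (simp add: exit_top_def)
    then show sp: "\<omega> \<in> space M" using regular_subset by auto
    interpret nonneg_telegraph_path X U D \<omega> c v by (rule regular_path[OF reg])
    show "position X U D c v (w + z) \<omega> \<le> c * w - v * z"
      by (rule position_le[OF velocity_measurable[OF sp], of n])
        (use \<omega> ones_le[of n] in \<open>auto simp: exit_top_def Suc_diff_le\<close>)
  qed
  then have "prob (\<Union>n. exit_top w z n) \<le> prob {\<omega> \<in> space M. position X U D c v (w + z) \<omega> \<le> c * w - v * z}"
    by (rule finite_measure_mono) measurable
  ultimately show ?thesis by simp
qed

end

section \<open>The balanced case\<close>

locale balanced_telegraph = linear_rate_telegraph M X U D c v b r lam mu p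
  for M :: "'a measure" and X :: "nat \<Rightarrow> 'a \<Rightarrow> nat" and U D :: "nat \<Rightarrow> 'a \<Rightarrow> real"
    and c v b r lam mu p :: real +
  fixes s m :: real
  assumes balance: "lam * v = mu * c"
    and s_def: "s = v / mu"
    and m_def: "m = s * ln (p / (1 - p))"
begin

lemma s_pos: "0 < s" and s_eq: "s = c / lam"
  using balance rates_pos v_pos by (auto simp: s_def field_simps)

lemma exp_m_over_s: "exp (m / s) = p / (1 - p)"
  using s_pos p_bounds by (simp add: m_def)

text \<open>
  The contribution of \<open>t\<close> to this exponent is \<open>(mu * c - lam * v) * t / (c + v)\<close>, which the
  balance of the rates cancels.
\<close>

lemma clock_exponent:
  assumes "w = (x + v * t) / (c + v)" "z = (c * t - x) / (c + v)"
  shows "mu * z - lam * w = - x / s"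
proof -
  have "c = lam * s" using s_eq rates_pos by simp
  moreover have "v = mu * s" using s_def rates_pos by simp
  ultimately have "mu = v / s" and "lam = c / s" using s_pos by simp_all
  moreover have "v / s * (a / d) - c / s * (e / d) = (v * a - c * e) / (s * d)" for a d e
    by (simp add: diff_divide_distrib)
  ultimately have "mu * z - lam * w = (v * (c * t - x) - c * (x + v * t)) / (s * (c + v))"
    unfolding assms by simp
  also have "\<dots> = - x * (c + v) / (s * (c + v))"
    by (simp add: algebra_simps)
  finally show ?thesis using c_pos v_pos by simp
qed

text \<open>
  The corner \<open>(w, z)\<close> is the solution of \<open>w + z = t\<close> and \<open>c * w - v * z = x\<close>; it lies in the
  closed quadrant exactly for \<open>x\<close> in the closed interval. The two bounds are the exits through the top
  and through the right side.
\<close>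

lemma cdf_bounds:
  assumes "x \<in> {- v * t..c * t}"
  shows "logistic_cdf m s x \<le> prob {\<omega> \<in> space M. position X U D c v t \<omega> \<le> x}"
    and "prob {\<omega> \<in> space M. position X U D c v t \<omega> < x} \<le> logistic_cdf m s x"
proof -
  define w where "w = (x + v * t) / (c + v)"
  define z where "z = (c * t - x) / (c + v)"
  have cv: "c + v > 0" using c_pos v_pos by simp
  have nn: "0 \<le> w" "0 \<le> z" using assms cv by (simp_all add: w_def z_def)
  have "w + z = ((c + v) * t) / (c + v)"
    by (simp add: w_def z_def add_divide_distrib[symmetric] algebra_simps)
  then have t: "w + z = t" using cv by simp
  have "c * w - v * z = ((c + v) * x) / (c + v)"
    by (simp add: w_def z_def diff_divide_distrib[symmetric] algebra_simps)
  then have x: "c * w - v * z = x" using cv by simp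
  define P where "P = p * exp (- (lam * w))"
  define Q where "Q = (1 - p) * exp (- (mu * z))"
  have PQ: "0 < P" "0 < Q" using p_bounds by (simp_all add: P_def Q_def)
  have "P / Q = exp (m / s) * exp (mu * z - lam * w)"
    using p_bounds by (simp add: P_def Q_def exp_m_over_s exp_diff exp_minus field_simps)
  also have "\<dots> = exp (- (x - m) / s)"
    unfolding clock_exponent[OF w_def z_def] by (simp add: exp_add[symmetric] diff_divide_distrib)
  finally have "logistic_cdf m s x = 1 / (1 + P / Q)" by (simp add: logistic_cdf_def)
  then have F: "logistic_cdf m s x = Q / (P + Q)" using PQ by (simp add: field_simps)
  show "logistic_cdf m s x \<le> prob {\<omega> \<in> space M. position X U D c v t \<omega> \<le> x}"
    using prob_position_le[OF nn] unfolding t x F P_def Q_def .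
  have "P / (P + Q) \<le> prob {\<omega> \<in> space M. x \<le> position X U D c v t \<omega>}"
    using prob_position_ge[OF nn] unfolding t x P_def Q_def .
  moreover have "{\<omega> \<in> space M. position X U D c v t \<omega> < x} = space M - {\<omega> \<in> space M. x \<le> position X U D c v t \<omega>}"
    by auto
  then have "prob {\<omega> \<in> space M. position X U D c v t \<omega> < x} = 1 - prob {\<omega> \<in> space M. x \<le> position X U D c v t \<omega>}"
    by (simp add: prob_compl)
  moreover have "1 - P / (P + Q) = Q / (P + Q)" using PQ by (simp add: field_simps)
  ultimately show "prob {\<omega> \<in> space M. position X U D c v t \<omega> < x} \<le> logistic_cdf m s x"
    unfolding F by linarith
qed

abbreviation "law t \<equiv> distr M borel (position X U D c v t)"

lemma law_prob_space: "prob_space (law t)"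
  by (rule prob_space_distr) simp

lemma measure_law:
  "measure (law t) {..x} = prob {\<omega> \<in> space M. position X U D c v t \<omega> \<le> x}"
  "measure (law t) {..<x} = prob {\<omega> \<in> space M. position X U D c v t \<omega> < x}"
  by (simp_all add: measure_distr vimage_def Int_def conj_commute)

lemma law_cdf:
  assumes "t > 0"
  shows "x \<in> {- v * t..<c * t} \<Longrightarrow> measure (law t) {..x} = logistic_cdf m s x"
    and "x \<in> {- v * t<..c * t} \<Longrightarrow> measure (law t) {..<x} = logistic_cdf m s x"
proof -
  have "continuous_on {- v * t..c * t} (logistic_cdf m s)"
    using DERIV_isCont[OF logistic_cdf_has_derivative] s_pos
    by (intro continuous_at_imp_continuous_on) simp
  note squeeze = cdf_eq_of_squeeze[OF law_prob_space[of t] _ this]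
  show "x \<in> {- v * t..<c * t} \<Longrightarrow> measure (law t) {..x} = logistic_cdf m s x"
    by (rule squeeze(1)) (simp_all add: measure_law cdf_bounds)
  show "x \<in> {- v * t<..c * t} \<Longrightarrow> measure (law t) {..<x} = logistic_cdf m s x"
    by (rule squeeze(2)) (simp_all add: measure_law cdf_bounds)
qed

lemma law_outside:
  assumes "t > 0"
  shows "emeasure (law t) (- {- v * t..c * t}) = 0"
proof -
  have "AE \<omega> in M. position X U D c v t \<omega> \<in> {- v * t..c * t}"
    using AE_regular
  proof eventually_elim
    case (elim \<omega>)
    interpret nonneg_telegraph_path X U D \<omega> c v by (rule regular_path[OF elim])
    have meas: "V \<in> borel_measurable borel"
      using elim regular_subset by (intro velocity_measurable) auto
    show ?case
      using V_integral_bounds[OF meas, of 0 t] assms by (simp add: position_eq_integral[OF meas])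
  qed
  then have "emeasure M (position X U D c v t -` (- {- v * t..c * t}) \<inter> space M) = 0"
    by (subst (asm) AE_iff_measurable[OF _ refl]) (auto simp: vimage_def Int_def conj_commute)
  then show ?thesis by (simp add: emeasure_distr)
qed

lemma position_cdf_has_derivative:
  assumes "t > 0" "- v * t < x" "x < c * t"
  shows "((\<lambda>y. prob {\<omega> \<in> space M. position X U D c v t \<omega> \<le> y}) has_real_derivative logistic_density m s x) (at x)"
proof (rule has_field_derivative_transform_within_open)
  show "(logistic_cdf m s has_real_derivative logistic_density m s x) (at x)"
    using s_pos by (intro logistic_cdf_has_derivative) simp
  show "open {- v * t<..<c * t}" "x \<in> {- v * t<..<c * t}" using assms by simp_all
  show "logistic_cdf m s y = prob {\<omega> \<in> space M. position X U D c v t \<omega> \<le> y}"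
    if "y \<in> {- v * t<..<c * t}" for y
    using law_cdf(1)[OF assms(1), of y] that by (simp add: measure_law)
qed

lemma position_density_eq:
  assumes "t > 0" "- v * t < x" "x < c * t"
  shows "position_density M X U D c v x t = logistic_density m s x"
  unfolding position_density_def by (rule DERIV_imp_deriv[OF position_cdf_has_derivative[OF assms]])

lemma position_ac_component_density:
  assumes "t > 0"
  shows "ac_component_density (law t)
    (\<lambda>x. if - v * t < x \<and> x < c * t then position_density M X U D c v x t else 0)"
proof -
  have "- v * t < c * t" using assms c_pos v_pos by (intro mult_strict_right_mono) auto
  then have "ac_component_density (law t) (\<lambda>x. if - v * t < x \<and> x < c * t then logistic_density m s x else 0)"
    using assms s_pos
    by (intro ac_component_density_of_cdf[where F="logistic_cdf m s"] law_prob_space law_outside law_cdf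
        logistic_cdf_has_derivative logistic_density_measurable logistic_density_nonneg) auto
  also have "(\<lambda>x. if - v * t < x \<and> x < c * t then logistic_density m s x else 0)
      = (\<lambda>x. if - v * t < x \<and> x < c * t then position_density M X U D c v x t else 0)"
    using position_density_eq[OF assms] by auto
  finally show ?thesis .
qed

text \<open>
  For fixed \<open>x\<close> the density is eventually constant in \<open>t\<close>: it has its final value as soon as \<open>x\<close>
  lies in the open interval of reachable positions.
\<close>

lemma position_density_tendsto:
  "((\<lambda>t. position_density M X U D c v x t) \<longlongrightarrow> logistic_density m s x) at_top"
proof (rule tendsto_eventually)
  show "\<forall>\<^sub>F t in at_top. position_density M X U D c v x t = logistic_density m s x"
    using eventually_gt_at_top[of 0] eventually_gt_at_top[of "- x / v"] eventually_gt_at_top[of "x / c"]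
  proof eventually_elim
    case (elim t)
    then show ?case
      using c_pos v_pos by (intro position_density_eq) (simp_all add: field_simps)
  qed
qed

end

theorem corollary4p2:
  fixes M :: "'a measure"
    and X :: "nat \<Rightarrow> 'a \<Rightarrow> nat" and U D :: "nat \<Rightarrow> 'a \<Rightarrow> real"
    and b r c v lam mu p m s :: real
  assumes model: "bernoulli_telegraph M X U D c v b r"
    and rates_pos: "lam > 0" "mu > 0"
    and U_exp: "\<And>k. k \<ge> 1 \<Longrightarrow> distributed M lborel (U k) (exponential_density (lam * real k))"
    and D_exp: "\<And>k. k \<ge> 1 \<Longrightarrow> distributed M lborel (D k) (exponential_density (mu * real k))"
    and balance: "lam * v = mu * c"
    and p_def: "p = b / (b + r)"
    and s_def: "s = v / mu"
    and m_def: "m = s * ln (p / (1 - p))"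
  shows "s = c / lam
    \<and> (\<forall>t>0. \<forall>x. - v * t < x \<and> x < c * t \<longrightarrow>
          (\<lambda>y. measure M {\<omega> \<in> space M. position X U D c v t \<omega> \<le> y}) differentiable at x
        \<and> position_density M X U D c v x t
            = exp (- (x - m) / s) / (s * (1 + exp (- (x - m) / s))\<^sup>2))
    \<and> (\<forall>t>0. ac_component_density (distr M borel (position X U D c v t))
          (\<lambda>x. if - v * t < x \<and> x < c * t then position_density M X U D c v x t else 0))
    \<and> (\<forall>x. ((\<lambda>t. position_density M X U D c v x t)
          \<longlongrightarrow> exp (- (x - m) / s) / (s * (1 + exp (- (x - m) / s))\<^sup>2)) at_top)"
proof -
  interpret bernoulli_telegraph M X U D c v b r by (rule model)
  interpret balanced_telegraph M X U D c v b r lam mu p s m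
    by unfold_locales (fact rates_pos U_exp D_exp p_def balance s_def m_def)+
  show ?thesis
    using s_eq position_cdf_has_derivative position_density_eq position_ac_component_density
      position_density_tendsto
    unfolding logistic_density_def by (auto simp: real_differentiable_def)
qed

end
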